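(* Let $n\ge 1$ be an arbitrary fixed integer. The number $f_n=|FM_n(\mathcal M)|$ of all distinct fuzzy matrices of order $n$ (i.e. the number of equivalence classes of $n\times n$ fuzzy matrices under $\cong$) is given by $$f_n=\sum_{k=0}^{n^2} f_{n,k}=\sum_{k=0}^{n^2}\left(\sum_{n_0=0}^{n^2-k}\ \sum_{n_1=1}^{n^2-n_0-k+1}\cdots\sum_{n_k=1}^{n^2-n_0-n_1-\cdots-n_{k-1}-k+k}\binom{n^2}{n_0}\binom{n^2-n_0}{n_1}\cdots\binom{n^2-n_0-n_1-\cdots-n_{k-1}}{n_k}\right),$$ where in the $k$-th summand the index $n_0$ runs over $0\le n_0\le n^2-k$ and, for $1\le j\le k$, the index $n_j$ runs over $1\le n_j\le n^2-n_0-\cdots-n_{j-1}-k+j$ (for $k=0$ the summand is $\sum_{n_0=0}^{n^2}\binom{n^2}{n_0}$).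
   Context: A fuzzy matrix of order $n$ is an $n\times n$ matrix $\tilde A=(a_{ij})$ with entries in the real interval $[0,1]$. Two fuzzy matrices $\tilde A=(a_{ij})$, $\tilde B=(b_{ij})$ of order $n$ are equivalent, $\tilde A\cong\tilde B$, if for all $i,j,r,s\in\{1,\dots,n\}$: (i) $a_{ij}>a_{rs}$ if and only if $b_{ij}>b_{rs}$; (ii) $a_{ij}=1$ if and only if $b_{ij}=1$; (iii) $a_{ij}=0$ if and only if $b_{ij}=0$. Two fuzzy matrices are distinct if they are not equivalent. A crisp matrix of order $n$ is an $n\times n$ matrix with entries in $\{0,1\}$; crisp matrices are ordered by $A\subseteq B$ iff $a_{ij}\le b_{ij}$ for all $i,j$, and $\subset$ denotes strict inclusion. A chain of crisp matrices of order $n$ of length $k$ ($0\le k\le n^2$) is a sequence $A_0\subset A_1\subset\cdots\subset A_k$ of crisp matrices of order $n$. $FM_{n,k}(\mathcal M)$ is the set of all chains of crisp matrices of order $n$ of length $k$ (no condition on the initial and terminal terms), $f_{n,k}=|FM_{n,k}(\mathcal M)|$; $FM_n(\mathcal M)$ is the set of all chains of crisp matrices of order $n$ (of any length), $f_n=|FM_n(\mathcal M)|$. The equivalence classes of fuzzy matrices of order $n$ are identified with the elements of $FM_n(\mathcal M)$: a fuzzy matrix $\tilde A$ corresponds to the chain of its distinct weak $\alpha$-cuts $\tilde A^{\alpha}$, $0<\alpha\le 1$, where $\tilde A^\alpha$ has $(i,j)$ entry $1$ if $a_{ij}\ge\alpha$ and $0$ otherwise. *)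

theory Defs
  imports Complex_Main "Jordan_Normal_Form.Matrix"
begin

definition fuzzy_matrices :: "nat \<Rightarrow> real mat set" where
  "fuzzy_matrices n = {A \<in> carrier_mat n n. \<forall>i<n. \<forall>j<n. A $$ (i, j) \<in> {0..1}}"

definition fuzzy_equiv :: "nat \<Rightarrow> (real mat \<times> real mat) set" where
  "fuzzy_equiv n = {(A, B). A \<in> fuzzy_matrices n \<and> B \<in> fuzzy_matrices n \<and>
     (\<forall>i<n. \<forall>j<n. \<forall>r<n. \<forall>s<n.
        (A $$ (i, j) > A $$ (r, s) \<longleftrightarrow> B $$ (i, j) > B $$ (r, s)) \<and>
        (A $$ (i, j) = 1 \<longleftrightarrow> B $$ (i, j) = 1) \<and>
        (A $$ (i, j) = 0 \<longleftrightarrow> B $$ (i, j) = 0))}"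

lemma equiv_fuzzy_equiv: "equiv (fuzzy_matrices n) (fuzzy_equiv n)"
  by (rule equivI) (auto simp: fuzzy_equiv_def refl_on_def sym_def trans_def)

definition crisp_matrices :: "nat \<Rightarrow> real mat set" where
  "crisp_matrices n = {A \<in> carrier_mat n n. \<forall>i<n. \<forall>j<n. A $$ (i, j) \<in> {0, 1}}"

text \<open>The order on matrices is the entrywise one, so \<open><\<close> is strict inclusion of crisp matrices.
  A chain \<open>A\<^sub>0 \<subset> \<dots> \<subset> A\<^sub>k\<close> of length \<open>k\<close> is a list with \<open>k + 1\<close> members.\<close>

definition FM_nk :: "nat \<Rightarrow> nat \<Rightarrow> real mat list set" where
  "FM_nk n k = {As. length As = k + 1 \<and> set As \<subseteq> crisp_matrices n \<and>
     (\<forall>i<k. As ! i < As ! (i + 1))}"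

definition FM_n :: "nat \<Rightarrow> real mat list set" where
  "FM_n n = (\<Union>k. FM_nk n k)"

definition f_nk :: "nat \<Rightarrow> nat \<Rightarrow> nat" where
  "f_nk n k = card (FM_nk n k)"

definition f_n :: "nat \<Rightarrow> nat" where
  "f_n n = card (FM_n n)"

text \<open>\<open>iterated_sum N k r ns\<close> is the result of the innermost \<open>r\<close> of the \<open>k + 1\<close> nested sums, as a
  function of the indices \<open>ns = [n\<^sub>0, \<dots>, n\<^sub>j\<^sub>-\<^sub>1]\<close> bound further out, where \<open>j = k + 1 - r\<close>.
  The upper bound \<open>N - n\<^sub>0 - \<dots> - n\<^sub>j\<^sub>-\<^sub>1 - k + j\<close> is arranged so that the subtraction on
  naturals never truncates for indices within their ranges, given \<open>k \<le> N\<close>.\<close>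

primrec iterated_sum :: "nat \<Rightarrow> nat \<Rightarrow> nat \<Rightarrow> nat list \<Rightarrow> nat" where
  "iterated_sum N k 0 ns = (\<Prod>j=0..k. (N - sum_list (take j ns)) choose (ns ! j))"
| "iterated_sum N k (Suc r) ns =
     (\<Sum>m = (if ns = [] then 0 else 1)..N + length ns - sum_list ns - k.
        iterated_sum N k r (ns @ [m]))"

end

theory Submission
  imports Defs
begin

text \<open>Both fuzzy matrices up to equivalence and chains of crisp matrices are determined by a
  nonempty set of subsets of the \<open>n\<^sup>2\<close> positions that is totally ordered by inclusion: a fuzzy matrix
  is recovered up to equivalence from its weak cuts, since \<open>x\<close> has a larger entry than \<open>y\<close> iff
  some cut contains \<open>x\<close> but not \<open>y\<close>, and the entry at \<open>x\<close> is 1 or 0 iff \<open>x\<close> lies in all cuts or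
  in none. Conversely, a chain is the set of cuts of the average of its members. Choosing
  the members of a chain one after the other, \<open>n\<^sub>j\<close> being the number of positions added in step
  \<open>j\<close>, gives the iterated sum.\<close>

section \<open>Chains of subsets of a finite set\<close>

definition subset_chains :: "'a set \<Rightarrow> nat \<Rightarrow> 'a set list set" where
  "subset_chains X k = {Ss. length Ss = k + 1 \<and> set Ss \<subseteq> Pow X \<and> successively (\<subset>) Ss}"

text \<open>The possible continuations of a chain whose last member so far is \<open>B\<close>. As
  \<open>B\<close> itself is not listed, \<open>k\<close> counts both members and strict
  steps.\<close>

definition chains_above :: "'a set \<Rightarrow> nat \<Rightarrow> 'a set \<Rightarrow> 'a set list set" where
  "chains_above X k B = {Ss. length Ss = k \<and> set Ss \<subseteq> Pow X \<and> successively (\<subset>) (B # Ss)}"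

text \<open>Counts the sequences of \<open>k\<close> pairwise disjoint nonempty subsets of an
  \<open>M\<close>-element set, i.e. the increments of a strict chain; in closed form k! S(M + 1, k
  + 1) with Stirling numbers of the second kind.\<close>

primrec chain_count :: "nat \<Rightarrow> nat \<Rightarrow> nat" where
  "chain_count 0 M = 1"
| "chain_count (Suc k) M = (\<Sum>m=1..M. (M choose m) * chain_count k (M - m))"

text \<open>Each increment uses up at least one point. This vanishing absorbs the difference between
  the upper limits in \<open>iterated_sum\<close> and in \<open>chain_count\<close>.\<close>

lemma chain_count_eq_0: "M < k \<Longrightarrow> chain_count k M = 0"
  by (induction k arbitrary: M) auto

text \<open>Strict inclusion is transitive. The adjacent form suits peeling off the first member,
  the pairwise form comparing arbitrary members.\<close>

lemma successively_psubset_iff: "successively (\<subset>) Ss \<longleftrightarrow> sorted_wrt (\<subset>) Ss"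
  by (rule successively_iff_sorted_wrt_strong) auto

lemma finite_subset_chains: "finite X \<Longrightarrow> finite (subset_chains X k)"
  by (rule finite_subset[OF _ finite_lists_length_eq[of "Pow X" "k + 1"]])
    (auto simp: subset_chains_def)

lemma finite_chains_above: "finite X \<Longrightarrow> finite (chains_above X k B)"
  by (rule finite_subset[OF _ finite_lists_length_eq[of "Pow X" k]])
    (auto simp: chains_above_def)

lemma subset_chains_eq_UN: "subset_chains X k = (\<Union>S\<in>Pow X. (#) S ` chains_above X k S)"
proof (intro Set.set_eqI)
  fix Ss
  show "Ss \<in> subset_chains X k \<longleftrightarrow> Ss \<in> (\<Union>S\<in>Pow X. (#) S ` chains_above X k S)"
    by (cases Ss) (simp_all add: subset_chains_def chains_above_def image_iff conj_ac)
qed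

lemma chains_above_Suc:
  "chains_above X (Suc k) B = (\<Union>S\<in>{S. B \<subset> S \<and> S \<subseteq> X}. (#) S ` chains_above X k S)"
proof (intro Set.set_eqI)
  fix Ss
  show "Ss \<in> chains_above X (Suc k) B \<longleftrightarrow>
      Ss \<in> (\<Union>S\<in>{S. B \<subset> S \<and> S \<subseteq> X}. (#) S ` chains_above X k S)"
    by (cases Ss) (simp_all add: chains_above_def image_iff conj_ac)
qed

section \<open>Counting chains by the sizes of their increments\<close>

lemma card_UN_Cons:
  assumes "finite A" "\<And>x. x \<in> A \<Longrightarrow> finite (F x)"
  shows "card (\<Union>x\<in>A. (#) x ` F x) = (\<Sum>x\<in>A. card (F x))"
proof -
  have "card (\<Union>x\<in>A. (#) x ` F x) = (\<Sum>x\<in>A. card ((#) x ` F x))"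
    using assms by (intro card_UN_disjoint) auto
  then show ?thesis
    by (simp add: card_image)
qed

text \<open>A superset of \<open>B\<close> within \<open>X\<close> is \<open>B \<union> T\<close>
  for a unique \<open>T \<subseteq> X - B\<close>; grouping these \<open>T\<close> by size produces
  the binomial coefficients.\<close>

lemma sum_supersets_card:
  fixes g :: "nat \<Rightarrow> nat"
  assumes "finite X" "B \<subseteq> X"
  shows "(\<Sum>S\<in>{S. B \<subseteq> S \<and> S \<subseteq> X}. g (card S)) =
    (\<Sum>m=0..card X - card B. ((card X - card B) choose m) * g (card B + m))"
proof -
  have fin: "finite (X - B)" "finite B"
    using assms finite_subset by auto
  have card: "card (X - B) = card X - card B"
    using assms fin by (simp add: card_Diff_subset)
  have card_Un: "card (B \<union> T) = card B + card T" if "T \<subseteq> X - B" for T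
    using that fin finite_subset[OF that] by (subst card_Un_disjoint) auto
  have card_split: "card B + card (S - B) = card S" if "B \<subseteq> S" "S \<subseteq> X" for S
    using that card_Un[of "S - B"] by (simp add: Un_absorb1 Diff_mono)
  have "(\<Sum>S\<in>{S. B \<subseteq> S \<and> S \<subseteq> X}. g (card S)) = (\<Sum>T\<in>Pow (X - B). g (card B + card T))"
    using assms
    by (intro sum.reindex_bij_witness[where i = "\<lambda>T. B \<union> T" and j = "\<lambda>S. S - B"])
      (auto simp: card_split)
  also have "\<dots> = (\<Sum>m\<in>{0..card (X - B)}. \<Sum>T\<in>{T \<in> Pow (X - B). card T = m}. g (card B + card T))"
    using fin by (intro sum.group[symmetric]) (auto intro!: card_mono)
  also have "\<dots> = (\<Sum>m=0..card (X - B). (card (X - B) choose m) * g (card B + m))"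
    using n_subsets[OF fin(1)] by (intro sum.cong) auto
  finally show ?thesis
    by (simp add: card)
qed

lemma card_chains_above:
  assumes "finite X" "B \<subseteq> X"
  shows "card (chains_above X k B) = chain_count k (card X - card B)"
  using assms(2)
proof (induction k arbitrary: B)
  case 0
  have "chains_above X 0 B = {[]}"
    by (auto simp: chains_above_def)
  then show ?case
    by simp
next
  case (Suc k)
  let ?M = "card X - card B"
  let ?g = "\<lambda>c. chain_count k (card X - c)"
  have fin: "finite {S. B \<subseteq> S \<and> S \<subseteq> X}" "finite {S. B \<subset> S \<and> S \<subseteq> X}"
    using assms(1) by auto
  have "card (chains_above X (Suc k) B) = (\<Sum>S\<in>{S. B \<subset> S \<and> S \<subseteq> X}. ?g (card S))"
    unfolding chains_above_Suc using assms(1) fin Suc.IH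
    by (simp add: card_UN_Cons finite_chains_above)
  \<comment> \<open>The sum over all supersets also contains \<open>S = B\<close>, which is the
    \<open>m = 0\<close> term on the other side; cancelling it leaves the proper supersets and the
    sum from 1.\<close>
  moreover have "{S. B \<subseteq> S \<and> S \<subseteq> X} = insert B {S. B \<subset> S \<and> S \<subseteq> X}"
    using Suc.prems by auto
  moreover have "(\<Sum>m=0..?M. (?M choose m) * ?g (card B + m)) =
      ?g (card B) + chain_count (Suc k) ?M"
    by (simp add: sum.atLeast_Suc_atMost)
  ultimately show ?case
    using sum_supersets_card[OF assms(1) Suc.prems, of ?g] fin by simp
qed

text \<open>The first member may be empty, hence the start at 0; all later increments are nonempty
  and left to \<open>chain_count\<close>.\<close>

lemma card_subset_chains:
  assumes "finite X"
  shows "card (subset_chains X k) = (\<Sum>m=0..card X. (card X choose m) * chain_count k (card X - m))"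
proof -
  have "card (subset_chains X k) = (\<Sum>S\<in>Pow X. chain_count k (card X - card S))"
    unfolding subset_chains_eq_UN using assms
    by (simp add: card_UN_Cons finite_chains_above card_chains_above)
  also have "Pow X = {S. {} \<subseteq> S \<and> S \<subseteq> X}"
    by auto
  finally show ?thesis
    using sum_supersets_card[OF assms, of "{}" "\<lambda>c. chain_count k (card X - c)"] by simp
qed

section \<open>Evaluating the iterated sum\<close>

text \<open>The binomials of the indices already bound are constant in the inner sums and factor
  out. The outermost sum is excluded by \<open>ns \<noteq> []\<close> because its index starts at 0
  instead of 1.\<close>

lemma iterated_sum_eq_chain_count:
  assumes "ns \<noteq> []" "length ns + r = k + 1"
  shows "iterated_sum N k r ns =
    (\<Prod>j<length ns. (N - sum_list (take j ns)) choose (ns ! j)) * chain_count r (N - sum_list ns)"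
  using assms
proof (induction r arbitrary: ns)
  case 0
  then have "{0..k} = {..<length ns}"
    by auto
  then show ?case
    by simp
next
  case (Suc r)
  let ?M = "N - sum_list ns"
  let ?P = "\<Prod>j<length ns. (N - sum_list (take j ns)) choose (ns ! j)"
  \<comment> \<open>Here \<open>k = length ns + r\<close>: the bound reserves one point for each of
    the \<open>r\<close> sums further in.\<close>
  have upper: "N + length ns - sum_list ns - k = ?M - r"
    using Suc.prems by simp
  have step: "iterated_sum N k r (ns @ [m]) = ?P * ((?M choose m) * chain_count r (?M - m))" for m
    using Suc.prems by (subst Suc.IH) (auto simp: nth_append algebra_simps)
  have "iterated_sum N k (Suc r) ns = (\<Sum>m=1..?M - r. ?P * ((?M choose m) * chain_count r (?M - m)))"
    using Suc.prems(1) unfolding iterated_sum.simps upper step by simp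
  \<comment> \<open>For \<open>m > ?M - r\<close> fewer than \<open>r\<close> points remain for
    \<open>r\<close> nonempty increments, so the added terms are 0.\<close>
  also have "\<dots> = (\<Sum>m=1..?M. ?P * ((?M choose m) * chain_count r (?M - m)))"
    by (intro sum.mono_neutral_left) (auto simp: chain_count_eq_0)
  finally show ?case
    by (simp add: sum_distrib_left)
qed

lemma iterated_sum_Nil:
  "iterated_sum N k (k + 1) [] = (\<Sum>m=0..N. (N choose m) * chain_count k (N - m))"
proof -
  have "iterated_sum N k (k + 1) [] = (\<Sum>m=0..N - k. (N choose m) * chain_count k (N - m))"
    by (simp add: iterated_sum_eq_chain_count)
  also have "\<dots> = (\<Sum>m=0..N. (N choose m) * chain_count k (N - m))"
    by (intro sum.mono_neutral_left) (auto simp: chain_count_eq_0)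
  finally show ?thesis .
qed

lemma subset_chains_eq_empty:
  assumes "finite X" "card X < k"
  shows "subset_chains X k = {}"
proof -
  have "card (subset_chains X k) = 0"
    using assms by (simp add: card_subset_chains chain_count_eq_0)
  then show ?thesis
    using finite_subset_chains[OF assms(1)] by simp
qed

section \<open>Crisp matrices as sets of positions\<close>

abbreviation positions :: "nat \<Rightarrow> (nat \<times> nat) set" where
  "positions n \<equiv> {..<n} \<times> {..<n}"

definition support :: "real mat \<Rightarrow> (nat \<times> nat) set" where
  "support A = {(i, j). i < dim_row A \<and> j < dim_col A \<and> A $$ (i, j) = 1}"

lemma support_inj_on: "inj_on support (crisp_matrices n)"
proof (rule inj_onI)
  fix A B assume A: "A \<in> crisp_matrices n" and B: "B \<in> crisp_matrices n"
    and eq: "support A = support B"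
  show "A = B"
  proof (rule eq_matI)
    fix i j assume "i < dim_row B" "j < dim_col B"
    then show "A $$ (i, j) = B $$ (i, j)"
      using A B eq[THEN eqset_imp_iff, of "(i, j)"]
      by (fastforce simp: support_def crisp_matrices_def)
  qed (use A B in \<open>auto simp: crisp_matrices_def\<close>)
qed

lemma support_image: "support ` crisp_matrices n = Pow (positions n)"
proof (intro equalityI subsetI)
  fix S assume "S \<in> Pow (positions n)"
  then have "S = support (mat n n (\<lambda>p. of_bool (p \<in> S)))"
    by (auto simp: support_def)
  moreover have "mat n n (\<lambda>p. of_bool (p \<in> S)) \<in> crisp_matrices n"
    by (auto simp: crisp_matrices_def)
  ultimately show "S \<in> support ` crisp_matrices n"
    by blast
qed (auto simp: support_def crisp_matrices_def)

text \<open>Between entries 0 and 1, \<open>\<le>\<close> is the implication that a 1 stays a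
  1.\<close>

lemma crisp_le_iff:
  assumes "A \<in> crisp_matrices n" "B \<in> crisp_matrices n"
  shows "A \<le> B \<longleftrightarrow> support A \<subseteq> support B"
proof -
  have dim: "dim_row A = n" "dim_col A = n" "dim_row B = n" "dim_col B = n"
    using assms by (auto simp: crisp_matrices_def)
  have entry: "A $$ (i, j) = 0 \<or> A $$ (i, j) = 1" "B $$ (i, j) = 0 \<or> B $$ (i, j) = 1"
    if "i < n" "j < n" for i j
    using assms that by (auto simp: crisp_matrices_def)
  have "A $$ (i, j) \<le> B $$ (i, j) \<longleftrightarrow> (A $$ (i, j) = 1 \<longrightarrow> B $$ (i, j) = 1)"
    if "i < n" "j < n" for i j
    using entry[OF that] by auto
  then have "A \<le> B \<longleftrightarrow> (\<forall>i<n. \<forall>j<n. A $$ (i, j) = 1 \<longrightarrow> B $$ (i, j) = 1)"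
    by (simp add: less_eq_mat_def dim)
  then show ?thesis
    by (auto simp: support_def dim)
qed

lemma crisp_less_iff:
  assumes "A \<in> crisp_matrices n" "B \<in> crisp_matrices n"
  shows "A < B \<longleftrightarrow> support A \<subset> support B"
  using crisp_le_iff[OF assms] crisp_le_iff[OF assms(2,1)] by (auto simp: less_mat_def)

text \<open>Serves to cut the bijection between all lists of crisp matrices and all lists of subsets
  down to chains, so that only the chain condition has to be transferred.\<close>

lemma bij_betw_restrict_iff:
  assumes bij: "bij_betw f A B" and iff: "\<And>x. x \<in> A \<Longrightarrow> f x \<in> B' \<longleftrightarrow> x \<in> A'"
    and sub: "A' \<subseteq> A" "B' \<subseteq> B"
  shows "bij_betw f A' B'"
proof (rule bij_betw_subset[OF bij sub(1)])
  show "f ` A' = B'"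
  proof (intro equalityI subsetI)
    fix y assume "y \<in> B'"
    moreover then obtain x where "x \<in> A" "y = f x"
      using bij sub(2) by (auto simp: bij_betw_def)
    ultimately show "y \<in> f ` A'"
      using iff by blast
  qed (use iff sub(1) in blast)
qed

lemma bij_betw_map_support:
  "bij_betw (map support) (FM_nk n k) (subset_chains (positions n) k)"
proof -
  have "bij_betw (map support) (lists (crisp_matrices n)) (lists (Pow (positions n)))"
    by (intro bij_lists) (simp add: bij_betw_def support_inj_on support_image)
  moreover have "map support As \<in> subset_chains (positions n) k \<longleftrightarrow> As \<in> FM_nk n k"
    if "As \<in> lists (crisp_matrices n)" for As
  proof -
    have crisp: "set As \<subseteq> crisp_matrices n"
      using that by auto
    then have "As ! i < As ! Suc i \<longleftrightarrow> support (As ! i) \<subset> support (As ! Suc i)"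
      if "Suc i < length As" for i
      using that by (intro crisp_less_iff[of _ n]) (auto dest: nth_mem)
    moreover have "support ` set As \<subseteq> Pow (positions n)"
      using crisp support_image by blast
    ultimately show ?thesis
      using crisp
      by (simp add: subset_chains_def FM_nk_def successively_conv_nth cong: conj_cong)
  qed
  moreover have "FM_nk n k \<subseteq> lists (crisp_matrices n)"
    by (auto simp: FM_nk_def)
  moreover have "subset_chains (positions n) k \<subseteq> lists (Pow (positions n))"
    by (auto simp: subset_chains_def)
  ultimately show ?thesis
    by (rule bij_betw_restrict_iff)
qed

lemma f_nk_eq: "f_nk n k = card (subset_chains (positions n) k)"
  unfolding f_nk_def by (rule bij_betw_same_card[OF bij_betw_map_support])

lemma f_n_eq_sum: "f_n n = (\<Sum>k=0..n\<^sup>2. f_nk n k)"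
proof -
  have fin: "finite (FM_nk n k)" for k
    using bij_betw_finite[OF bij_betw_map_support] finite_subset_chains[of "positions n"] by simp
  \<comment> \<open>There are only \<open>n\<^sup>2\<close> positions to add, so the union over all
    lengths is a finite one; it is disjoint since the length of the list determines
    \<open>k\<close>.\<close>
  have "FM_nk n k = {}" if "n\<^sup>2 < k" for k
    using that bij_betw_map_support[of n k]
    by (simp add: subset_chains_eq_empty power2_eq_square bij_betw_def)
  then have "FM_n n = (\<Union>k\<in>{0..n\<^sup>2}. FM_nk n k)"
    by (force simp: FM_n_def not_less)
  moreover have "card (\<Union>k\<in>{0..n\<^sup>2}. FM_nk n k) = (\<Sum>k=0..n\<^sup>2. f_nk n k)"
    unfolding f_nk_def using fin
    by (intro card_UN_disjoint) (auto simp: FM_nk_def)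
  ultimately show ?thesis
    by (simp add: f_n_def)
qed

section \<open>Weak cuts\<close>

text \<open>A set of cuts forgets the thresholds. Threshold 1 is included, so the empty set is a cut
  iff no entry is 1; threshold 0 is excluded, so all positions form a cut iff no entry is 0.\<close>

definition weak_cuts :: "nat \<Rightarrow> real mat \<Rightarrow> (nat \<times> nat) set set" where
  "weak_cuts n A = (\<lambda>\<alpha>. {p \<in> positions n. A $$ p \<ge> \<alpha>}) ` {0<..1}"

lemma fuzzy_entry:
  assumes "A \<in> fuzzy_matrices n" "p \<in> positions n"
  shows "0 \<le> A $$ p" "A $$ p \<le> 1"
  using assms by (auto simp: fuzzy_matrices_def)

text \<open>A nonempty cut is also the cut at its own smallest entry, at \<open>p\<close> say. This
  describes it by comparisons with \<open>p\<close> alone, so \<open>B $$ p\<close> is a threshold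
  giving the same set. The hypotheses are symmetric, so equality follows by swapping
  \<open>A\<close> and \<open>B\<close>.\<close>

lemma weak_cuts_mono:
  assumes "A \<in> fuzzy_matrices n" "B \<in> fuzzy_matrices n"
    and less: "\<And>p q. p \<in> positions n \<Longrightarrow> q \<in> positions n \<Longrightarrow> A $$ p > A $$ q \<longleftrightarrow> B $$ p > B $$ q"
    and one: "\<And>p. p \<in> positions n \<Longrightarrow> A $$ p = 1 \<longleftrightarrow> B $$ p = 1"
    and zero: "\<And>p. p \<in> positions n \<Longrightarrow> A $$ p = 0 \<longleftrightarrow> B $$ p = 0"
  shows "weak_cuts n A \<subseteq> weak_cuts n B"
proof
  fix S assume "S \<in> weak_cuts n A"
  then obtain \<alpha> where \<alpha>: "0 < \<alpha>" "\<alpha> \<le> 1" and S: "S = {p \<in> positions n. A $$ p \<ge> \<alpha>}"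
    by (auto simp: weak_cuts_def)
  obtain \<beta> where "0 < \<beta>" "\<beta> \<le> 1" "S = {p \<in> positions n. B $$ p \<ge> \<beta>}"
  proof (cases "S = {}")
    case True
    \<comment> \<open>An empty cut means that \<open>A\<close> has no entry 1, hence neither has
      \<open>B\<close>, and threshold 1 works.\<close>
    then have "\<not> B $$ p \<ge> 1" if "p \<in> positions n" for p
      using that S \<alpha> one[OF that] fuzzy_entry[OF assms(2) that] by force
    then show ?thesis
      using True by (intro that[of 1]) auto
  next
    case False
    have "finite S"
      using S by simp
    then obtain p where p: "p \<in> S" and min: "\<And>q. q \<in> S \<Longrightarrow> A $$ p \<le> A $$ q"
      using False arg_min_if_finite[of S "\<lambda>p. A $$ p"] by (metis not_less)
    have pos: "p \<in> positions n" "A $$ p \<ge> \<alpha>"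
      using p S by auto
    have "S = {q \<in> positions n. \<not> A $$ q < A $$ p}"
      using S min pos by (force simp: not_less)
    then have "S = {q \<in> positions n. B $$ p \<le> B $$ q}"
      using less pos(1) by (simp add: not_less cong: conj_cong)
    \<comment> \<open>Agreement on zeros makes \<open>B $$ p\<close> an admissible
      threshold.\<close>
    moreover have "0 < B $$ p"
      using zero[OF pos(1)] fuzzy_entry[OF assms(2) pos(1)] pos(2) \<alpha> by linarith
    ultimately show ?thesis
      using fuzzy_entry[OF assms(2) pos(1)] that by blast
  qed
  then show "S \<in> weak_cuts n B"
    by (auto simp: weak_cuts_def)
qed

lemma less_iff_weak_cuts:
  assumes "A \<in> fuzzy_matrices n" "p \<in> positions n" "q \<in> positions n"
  shows "A $$ p > A $$ q \<longleftrightarrow> (\<exists>S\<in>weak_cuts n A. p \<in> S \<and> q \<notin> S)"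
proof
  assume "A $$ p > A $$ q"
  \<comment> \<open>The cut at height \<open>A $$ p\<close> separates the two; the height is
    positive because \<open>A $$ q \<ge> 0\<close>.\<close>
  then show "\<exists>S\<in>weak_cuts n A. p \<in> S \<and> q \<notin> S"
    using assms fuzzy_entry[OF assms(1,2)] fuzzy_entry[OF assms(1,3)]
    by (intro bexI[of _ "{r \<in> positions n. A $$ r \<ge> A $$ p}"]) (auto simp: weak_cuts_def)
qed (use assms in \<open>auto simp: weak_cuts_def\<close>)

lemma eq_1_iff_weak_cuts:
  assumes "A \<in> fuzzy_matrices n" "p \<in> positions n"
  shows "A $$ p = 1 \<longleftrightarrow> (\<forall>S\<in>weak_cuts n A. p \<in> S)"
proof
  assume "\<forall>S\<in>weak_cuts n A. p \<in> S"
  then have "A $$ p \<ge> 1"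
    by (auto simp: weak_cuts_def)
  then show "A $$ p = 1"
    using fuzzy_entry[OF assms] by simp
qed (use assms in \<open>auto simp: weak_cuts_def\<close>)

lemma eq_0_iff_weak_cuts:
  assumes "A \<in> fuzzy_matrices n" "p \<in> positions n"
  shows "A $$ p = 0 \<longleftrightarrow> (\<forall>S\<in>weak_cuts n A. p \<notin> S)"
proof
  assume *: "\<forall>S\<in>weak_cuts n A. p \<notin> S"
  have "\<not> 0 < A $$ p"
    using * assms fuzzy_entry[OF assms] by (auto simp: weak_cuts_def)
  then show "A $$ p = 0"
    using fuzzy_entry[OF assms] by simp
qed (use assms in \<open>auto simp: weak_cuts_def\<close>)

lemma fuzzy_equiv_iff_weak_cuts:
  assumes A: "A \<in> fuzzy_matrices n" and B: "B \<in> fuzzy_matrices n"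
  shows "(A, B) \<in> fuzzy_equiv n \<longleftrightarrow> weak_cuts n A = weak_cuts n B"
proof
  assume "(A, B) \<in> fuzzy_equiv n"
  then have less: "A $$ p > A $$ q \<longleftrightarrow> B $$ p > B $$ q"
    and one: "A $$ p = 1 \<longleftrightarrow> B $$ p = 1" and zero: "A $$ p = 0 \<longleftrightarrow> B $$ p = 0"
    if "p \<in> positions n" "q \<in> positions n" for p q
    using that by (force simp: fuzzy_equiv_def)+
  show "weak_cuts n A = weak_cuts n B"
  proof
    show "weak_cuts n A \<subseteq> weak_cuts n B"
      using less one zero by (intro weak_cuts_mono A B) blast+
    show "weak_cuts n B \<subseteq> weak_cuts n A"
      using less one zero by (intro weak_cuts_mono A B) blast+
  qed
next
  assume eq: "weak_cuts n A = weak_cuts n B"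
  have "A $$ p > A $$ q \<longleftrightarrow> B $$ p > B $$ q" "A $$ p = 1 \<longleftrightarrow> B $$ p = 1" "A $$ p = 0 \<longleftrightarrow> B $$ p = 0"
    if "p \<in> positions n" "q \<in> positions n" for p q
    using eq that
    by (simp_all only: less_iff_weak_cuts[OF A] less_iff_weak_cuts[OF B]
        eq_1_iff_weak_cuts[OF A] eq_1_iff_weak_cuts[OF B]
        eq_0_iff_weak_cuts[OF A] eq_0_iff_weak_cuts[OF B])
  then show "(A, B) \<in> fuzzy_equiv n"
    using A B by (auto simp: fuzzy_equiv_def)
qed

text \<open>The classes are the nonempty fibres of \<open>f\<close>, and a nonempty fibre determines
  its value.\<close>

lemma card_quotient_eq_card_image:
  assumes "equiv S r" "\<And>x y. x \<in> S \<Longrightarrow> y \<in> S \<Longrightarrow> (x, y) \<in> r \<longleftrightarrow> f x = f y"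
  shows "card (S // r) = card (f ` S)"
proof -
  let ?g = "\<lambda>z. {x \<in> S. f x = z}"
  have class_eq: "r `` {x} = ?g (f x)" if "x \<in> S" for x
    using that assms equiv_type[OF assms(1)] by auto
  then have "S // r = ?g ` f ` S"
    by (auto simp: quotient_def)
  moreover have "inj_on ?g (f ` S)"
    by (auto simp: inj_on_def)
  ultimately show ?thesis
    by (simp add: card_image)
qed

section \<open>Sets of cuts and chains\<close>

text \<open>Cardinalities increase strictly along a chain of finite sets, so the set of members
  fixes the list of cardinalities; \<open>card\<close> is injective on the members, which recovers
  the list itself.\<close>

lemma inj_on_set_sorted_psubset:
  "inj_on set {Ss. set Ss \<subseteq> Pow X \<and> sorted_wrt (\<subset>) Ss}" if "finite X"
proof (rule inj_onI, clarify)
  fix Ss Ts :: "'a set list"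
  assume sub: "set Ss \<subseteq> Pow X" and Ss: "sorted_wrt (\<subset>) Ss" and Ts: "sorted_wrt (\<subset>) Ts"
    and eq: "set Ss = set Ts"
  have fin: "finite S" if "S \<in> set Ss" for S
    using that sub \<open>finite X\<close> finite_subset by blast
  have "sorted_wrt (<) (map card Ss)" "sorted_wrt (<) (map card Ts)"
    unfolding sorted_wrt_map
    by (rule sorted_wrt_mono_rel[OF _ Ss] sorted_wrt_mono_rel[OF _ Ts];
        use fin eq in \<open>auto intro: psubset_card_mono\<close>)+
  then have "map card Ss = map card Ts"
    using eq by (intro strict_sorted_equal) auto
  moreover have "inj_on card (set Ss)"
  proof (rule inj_onI)
    fix S T assume ST: "S \<in> set Ss" "T \<in> set Ss" "card S = card T"
    then have "S \<subseteq> T \<or> T \<subseteq> S"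
      using sorted_wrt_nth_less[OF Ss] by (metis in_set_conv_nth linorder_neqE_nat order.refl psubset_imp_subset)
    then show "S = T"
      using ST fin by (metis card_subset_eq)
  qed
  ultimately show "Ss = Ts"
    using eq by (metis inj_on_map_eq_map sup.idem)
qed

text \<open>Comparable finite sets of equal size coincide, so \<open>K\<close> can be listed by
  sorting the cardinalities and mapping them back.\<close>

lemma ex_sorted_psubset:
  assumes "finite K" "\<And>S. S \<in> K \<Longrightarrow> finite S" "\<And>S T. S \<in> K \<Longrightarrow> T \<in> K \<Longrightarrow> S \<subseteq> T \<or> T \<subseteq> S"
  obtains Ss where "set Ss = K" "sorted_wrt (\<subset>) Ss"
proof -
  let ?g = "inv_into K card"
  have inj: "inj_on card K"
    using assms by (metis (no_types, lifting) card_subset_eq inj_onI)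
  have "set (map ?g (sorted_list_of_set (card ` K))) = K"
    using assms(1) inj by (simp add: image_image)
  moreover have "sorted_wrt (\<subset>) (map ?g (sorted_list_of_set (card ` K)))"
    unfolding sorted_wrt_map
  proof (rule sorted_wrt_mono_rel)
    show "sorted_wrt (<) (sorted_list_of_set (card ` K))"
      by simp
    fix a b assume "a \<in> set (sorted_list_of_set (card ` K))" "b \<in> set (sorted_list_of_set (card ` K))" "a < b"
    then obtain S T where "S \<in> K" "T \<in> K" "a = card S" "b = card T" "card S < card T"
      using assms(1) by auto
    then show "?g a \<subset> ?g b"
      using assms(2,3) inj card_mono[of S T] card_mono[of T S] by (auto simp: not_le)
  qed
  ultimately show ?thesis
    by (rule that)
qed

section \<open>A fuzzy matrix with prescribed cuts\<close>

definition chain_average :: "nat \<Rightarrow> (nat \<times> nat) set list \<Rightarrow> real mat" where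
  "chain_average n Ss = mat n n (\<lambda>p. real (card {i. i < length Ss \<and> p \<in> Ss ! i}) / real (length Ss))"

text \<open>For the empty list every entry is \<open>0 / 0 = 0\<close>, again in the unit
  interval.\<close>

lemma chain_average_fuzzy: "chain_average n Ss \<in> fuzzy_matrices n"
proof -
  have "card {i. i < length Ss \<and> p \<in> Ss ! i} \<le> length Ss" for p
    using card_mono[of "{..<length Ss}" "{i. i < length Ss \<and> p \<in> Ss ! i}"] by auto
  then show ?thesis
    by (auto simp: chain_average_def fuzzy_matrices_def divide_le_eq_1)
qed

text \<open>The members containing \<open>p\<close> form a final segment of the chain, so its length
  decides which members these are.\<close>

lemma in_nth_chain_iff:
  assumes "sorted_wrt (\<subset>) Ss" "i < length Ss"
  shows "p \<in> Ss ! i \<longleftrightarrow> length Ss - i \<le> card {j. j < length Ss \<and> p \<in> Ss ! j}"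
proof
  assume "p \<in> Ss ! i"
  then have "{i..<length Ss} \<subseteq> {j. j < length Ss \<and> p \<in> Ss ! j}"
    using assms sorted_wrt_nth_less[OF assms(1)] by (force simp: le_less)
  from card_mono[OF _ this] show "length Ss - i \<le> card {j. j < length Ss \<and> p \<in> Ss ! j}"
    by simp
next
  assume le: "length Ss - i \<le> card {j. j < length Ss \<and> p \<in> Ss ! j}"
  show "p \<in> Ss ! i"
  proof (rule ccontr)
    assume "p \<notin> Ss ! i"
    then have "p \<notin> Ss ! j" if "j \<le> i" for j
      using that assms(2) sorted_wrt_nth_less[OF assms(1), of j i] by (cases "j = i") auto
    then have "{j. j < length Ss \<and> p \<in> Ss ! j} \<subseteq> {Suc i..<length Ss}"
      by (auto simp: Suc_le_eq not_le[symmetric])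
    from card_mono[OF _ this] show False
      using le assms(2) by simp
  qed
qed

lemma weak_cuts_chain_average:
  assumes "sorted_wrt (\<subset>) Ss" "Ss \<noteq> []" "set Ss \<subseteq> Pow (positions n)"
  shows "weak_cuts n (chain_average n Ss) = set Ss"
proof -
  let ?m = "length Ss"
  let ?A = "chain_average n Ss"
  have m: "0 < ?m"
    using assms(2) by simp
  \<comment> \<open>An average reaches \<open>\<alpha>\<close> iff at least
    \<open>\<lceil>\<alpha> * ?m\<rceil>\<close> members contain the position. This number lies
    between 1 and \<open>?m\<close>, so the index is valid.\<close>
  have cut: "{p \<in> positions n. ?A $$ p \<ge> \<alpha>} = Ss ! (?m - nat \<lceil>\<alpha> * ?m\<rceil>)"
    if "0 < \<alpha>" "\<alpha> \<le> 1" for \<alpha> :: real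
  proof -
    let ?t = "nat \<lceil>\<alpha> * ?m\<rceil>"
    have "\<alpha> * ?m \<le> ?m"
      using that by (simp add: mult_left_le_one_le)
    then have t: "0 < ?t" "?t \<le> ?m"
      using that m by (auto simp: nat_ceiling_le_eq)
    have "?A $$ p \<ge> \<alpha> \<longleftrightarrow> p \<in> Ss ! (?m - ?t)" if "p \<in> positions n" for p
    proof -
      have "?A $$ p \<ge> \<alpha> \<longleftrightarrow> ?t \<le> card {j. j < ?m \<and> p \<in> Ss ! j}"
        using that m by (auto simp: chain_average_def nat_ceiling_le_eq pos_le_divide_eq)
      then show ?thesis
        using t m by (simp add: in_nth_chain_iff[OF assms(1)])
    qed
    moreover have "Ss ! (?m - ?t) \<subseteq> positions n"
      using assms(3) t m by (metis Pow_iff diff_less nth_mem subsetD)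
    ultimately show ?thesis
      by blast
  qed
  show ?thesis
  proof (intro equalityI subsetI)
    fix S assume "S \<in> weak_cuts n ?A"
    then show "S \<in> set Ss"
      using m by (auto simp: weak_cuts_def cut intro!: nth_mem diff_less)
  next
    fix S assume "S \<in> set Ss"
    then obtain i where i: "i < ?m" "S = Ss ! i"
      by (auto simp: in_set_conv_nth)
    \<comment> \<open>Chosen so that \<open>\<alpha> * ?m\<close> is the integer
      \<open>?m - i\<close>, which makes the cut the member at index \<open>i\<close>.\<close>
    define \<alpha> where "\<alpha> = real (?m - i) / real ?m"
    have "\<alpha> * ?m = real (?m - i)"
      using m by (simp add: \<alpha>_def)
    then have "nat \<lceil>\<alpha> * ?m\<rceil> = ?m - i"
      by simp
    moreover have \<alpha>: "0 < \<alpha>" "\<alpha> \<le> 1"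
      using i m by (auto simp: \<alpha>_def divide_le_eq_1)
    ultimately have "{p \<in> positions n. ?A $$ p \<ge> \<alpha>} = S"
      using i by (simp add: cut)
    then show "S \<in> weak_cuts n ?A"
      using \<alpha> by (auto simp: weak_cuts_def)
  qed
qed

section \<open>Counting the equivalence classes\<close>

lemma weak_cuts_image:
  "weak_cuts n ` fuzzy_matrices n = set ` (\<Union>k. subset_chains (positions n) k)"
proof (intro equalityI subsetI)
  fix K assume "K \<in> weak_cuts n ` fuzzy_matrices n"
  then obtain A where K: "K = weak_cuts n A"
    by auto
  have sub: "K \<subseteq> Pow (positions n)"
    unfolding K weak_cuts_def by blast
  have "K \<noteq> {}"
    by (simp add: K weak_cuts_def)
  have "finite K"
    by (rule finite_subset[OF sub]) simp
  moreover have "finite S" if "S \<in> K" for S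
    by (rule finite_subset[of S "positions n"]) (use that sub in auto)
  moreover have "S \<subseteq> T \<or> T \<subseteq> S" if ST: "S \<in> K" "T \<in> K" for S T
  proof -
    obtain \<alpha> \<beta> where "S = {p \<in> positions n. A $$ p \<ge> \<alpha>}" "T = {p \<in> positions n. A $$ p \<ge> \<beta>}"
      using ST unfolding K weak_cuts_def by blast
    then show ?thesis
      using linear[of \<alpha> \<beta>] by (auto simp del: mem_Sigma_iff)
  qed
  ultimately obtain Ss where Ss: "set Ss = K" "sorted_wrt (\<subset>) Ss"
    using ex_sorted_psubset by blast
  then have "Ss \<noteq> []"
    using \<open>K \<noteq> {}\<close> by auto
  \<comment> \<open>A chain of length \<open>k\<close> has \<open>k + 1\<close> members; as
    \<open>Ss\<close> is nonempty, the subtraction does not truncate.\<close>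
  then have "Ss \<in> subset_chains (positions n) (length Ss - 1)"
    using Ss sub by (simp add: subset_chains_def successively_psubset_iff)
  then show "K \<in> set ` (\<Union>k. subset_chains (positions n) k)"
    using Ss(1) by blast
next
  fix K assume "K \<in> set ` (\<Union>k. subset_chains (positions n) k)"
  then obtain Ss k where "K = set Ss" "Ss \<in> subset_chains (positions n) k"
    by blast
  then have "K = set Ss" "sorted_wrt (\<subset>) Ss" "Ss \<noteq> []" "set Ss \<subseteq> Pow (positions n)"
    by (auto simp only: subset_chains_def successively_psubset_iff mem_Collect_eq list.size)
  then have "K = weak_cuts n (chain_average n Ss)"
    by (simp add: weak_cuts_chain_average)
  then show "K \<in> weak_cuts n ` fuzzy_matrices n"
    using chain_average_fuzzy by blast
qed

lemma card_fuzzy_classes: "card (fuzzy_matrices n // fuzzy_equiv n) = f_n n"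
proof -
  let ?C = "\<Union>k. subset_chains (positions n) k"
  have "card (fuzzy_matrices n // fuzzy_equiv n) = card (set ` ?C)"
    using card_quotient_eq_card_image[OF equiv_fuzzy_equiv fuzzy_equiv_iff_weak_cuts]
    by (simp add: weak_cuts_image)
  also have "\<dots> = card ?C"
  proof (rule card_image, rule inj_on_subset)
    show "inj_on set {Ss. set Ss \<subseteq> Pow (positions n) \<and> sorted_wrt (\<subset>) Ss}"
      by (rule inj_on_set_sorted_psubset) simp
    show "?C \<subseteq> {Ss. set Ss \<subseteq> Pow (positions n) \<and> sorted_wrt (\<subset>) Ss}"
      unfolding subset_chains_def successively_psubset_iff by blast
  qed
  also have "\<dots> = card (FM_n n)"
  proof -
    have "bij_betw (map support) (FM_n n) ?C"
      unfolding bij_betw_def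
    proof
      show "map support ` FM_n n = ?C"
        using bij_betw_imp_surj_on[OF bij_betw_map_support] by (simp add: FM_n_def image_UN)
      \<comment> \<open>Injectivity for each length would not suffice on the union; it comes from
        \<open>support\<close> being injective on all crisp matrices.\<close>
      have "\<Union> (set ` FM_n n) \<subseteq> crisp_matrices n"
        unfolding FM_n_def FM_nk_def by blast
      then show "inj_on (map support) (FM_n n)"
        by (intro inj_on_mapI inj_on_subset[OF support_inj_on])
    qed
    then show ?thesis
      by (simp add: bij_betw_same_card)
  qed
  finally show ?thesis
    by (simp add: f_n_def)
qed

theorem theorem3p5:
  fixes n :: nat
  assumes "n \<ge> 1"
  shows "card (fuzzy_matrices n // fuzzy_equiv n) = f_n n \<and>
    f_n n = (\<Sum>k=0..n\<^sup>2. f_nk n k) \<and>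
    (\<Sum>k=0..n\<^sup>2. f_nk n k) = (\<Sum>k=0..n\<^sup>2. iterated_sum (n\<^sup>2) k (k + 1) [])"
proof -
  \<comment> \<open>Both sides reduce to the same sum over the size of the first member, with
    \<open>n\<^sup>2\<close> the number of positions.\<close>
  have "f_nk n k = iterated_sum (n\<^sup>2) k (k + 1) []" for k
    unfolding iterated_sum_Nil f_nk_eq
    by (simp add: card_subset_chains power2_eq_square)
  then show ?thesis
    by (simp only: card_fuzzy_classes f_n_eq_sum)
qed

end
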